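(* Let $Q=\prod_{j=1}^n(a_j,b_j)\subset\mathbb R^n$ with $a_j<b_j$, let $S_j=\{w\in\mathbb C:a_j<\operatorname{Re}w<b_j\}$ and $S_Q=\prod_{j=1}^nS_j\subset\mathbb C^n$, so that $Q=S_Q\cap\mathbb R^n$. For $p\in Q$ and $v\in\mathbb R^n$ put $$\mathcal F_Q(p;v)=\max_{1\le j\le n}\frac{2|v_j|}{A_j(p_j)},\qquad A_j(p_j)=\frac{2(b_j-a_j)}{\pi}\sin\frac{\pi(p_j-a_j)}{b_j-a_j},$$ and let $d_Q$ be the path distance on $Q$ induced by $\mathcal F_Q$. Then for all $p,q\in Q$ and $v\in\mathbb R^n$, $$\mathcal F_Q(p;v)=2\kappa_{S_Q}(p;v),\qquad d_Q(p,q)=2k_{S_Q}(p,q),$$ $$d_Q(p,q)=\max_{1\le j\le n}\left|\log\frac{\tan\left(\frac{\pi(q_j-a_j)}{2(b_j-a_j)}\right)}{\tan\left(\frac{\pi(p_j-a_j)}{2(b_j-a_j)}\right)}\right|,$$ and the metric space $(Q,d_Q)$ is complete.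
   Context: $\kappa_{\Omega}$ and $k_\Omega$ denote the Kobayashi–Royden infinitesimal metric and the Kobayashi distance of a domain $\Omega\subset\mathbb C^n$, normalized so that $\kappa_{\mathbb D}(z;\xi)=|\xi|/(1-|z|^2)$ on the unit disk $\mathbb D$ (and $k_{\mathbb D}$ is the distance induced by this metric). The path distance induced by a continuous family of norms $\mathcal F(p;\cdot)$ is the infimum of the lengths $\int\mathcal F(\gamma(s);\gamma'(s))\,ds$ over piecewise $C^1$ curves $\gamma$ joining the two points. *)

theory Defs
  imports "HOL-Complex_Analysis.Complex_Analysis"
begin

text \<open>
  The curve is \<open>C\<^sup>1\<close> up to the end points of every closed subinterval of a finite partition.
  The library predicate \<^const>\<open>piecewise_C1_differentiable_on\<close> does not control the
  derivative near the break points: it admits curves of infinite length, to which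
  \<^const>\<open>integral\<close> would assign length \<open>0\<close>.
\<close>
definition piecewise_C1_curve :: "(real \<Rightarrow> 'a::real_normed_vector) \<Rightarrow> bool" where
  "piecewise_C1_curve \<gamma> \<longleftrightarrow>
     (\<exists>N t. t 0 = 0 \<and> t N = 1 \<and>
        (\<forall>i<N. t i < t (Suc i) \<and>
           (\<exists>D. continuous_on {t i..t (Suc i)} D \<and>
              (\<forall>s\<in>{t i..t (Suc i)}.
                 (\<gamma> has_vector_derivative D s) (at s within {t i..t (Suc i)})))))"

definition curve_length ::
    "('a::real_normed_vector \<Rightarrow> 'a \<Rightarrow> real) \<Rightarrow> (real \<Rightarrow> 'a) \<Rightarrow> real" where
  "curve_length F \<gamma> = integral {0..1} (\<lambda>s. F (\<gamma> s) (vector_derivative \<gamma> (at s)))"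

text \<open>
  The value \<open>0\<close> off \<open>M\<close> is a convention: \<^const>\<open>Inf\<close> of the empty set of reals is
  unspecified, while \<^locale>\<open>Metric_space\<close> asks for nonnegativity off the carrier as well.
\<close>
definition path_distance ::
    "('a::real_normed_vector \<Rightarrow> 'a \<Rightarrow> real) \<Rightarrow> 'a set \<Rightarrow> 'a \<Rightarrow> 'a \<Rightarrow> real" where
  "path_distance F M p q =
     (if p \<in> M \<and> q \<in> M
      then Inf {curve_length F \<gamma> |\<gamma>.
             piecewise_C1_curve \<gamma> \<and> \<gamma> ` {0..1} \<subseteq> M \<and> \<gamma> 0 = p \<and> \<gamma> 1 = q}
      else 0)"

definition holomorphic_disk :: "(complex ^ 'n) set \<Rightarrow> (complex \<Rightarrow> complex ^ 'n) \<Rightarrow> bool" where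
  "holomorphic_disk \<Omega> \<phi> \<longleftrightarrow>
     (\<forall>j. (\<lambda>z. \<phi> z $ j) holomorphic_on ball 0 1) \<and> \<phi> ` ball 0 1 \<subseteq> \<Omega>"

definition kobayashi_royden :: "(complex ^ 'n) set \<Rightarrow> complex ^ 'n \<Rightarrow> complex ^ 'n \<Rightarrow> real" where
  "kobayashi_royden \<Omega> p \<xi> =
     Inf {cmod \<alpha> |\<alpha> \<phi>. holomorphic_disk \<Omega> \<phi> \<and> \<phi> 0 = p \<and>
            \<alpha> *s (\<chi> j. deriv (\<lambda>z. \<phi> z $ j) 0) = \<xi>}"

definition poincare_distance :: "complex \<Rightarrow> complex \<Rightarrow> real" where
  "poincare_distance = path_distance (\<lambda>z \<xi>. cmod \<xi> / (1 - (cmod z)\<^sup>2)) (ball 0 1)"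

text \<open>Kobayashi's definition by chains of holomorphic disks.\<close>
definition kobayashi_distance ::
    "(complex ^ 'n) set \<Rightarrow> complex ^ 'n \<Rightarrow> complex ^ 'n \<Rightarrow> real" where
  "kobayashi_distance \<Omega> z w =
     Inf {(\<Sum>i<N. poincare_distance (\<zeta> i) (\<omega> i)) |N P \<phi> \<zeta> \<omega>.
            P 0 = z \<and> P N = w \<and>
            (\<forall>i<N. holomorphic_disk \<Omega> (\<phi> i) \<and> \<zeta> i \<in> ball 0 1 \<and> \<omega> i \<in> ball 0 1 \<and>
               \<phi> i (\<zeta> i) = P i \<and> \<phi> i (\<omega> i) = P (Suc i))}"

definition complex_vec :: "real ^ 'n \<Rightarrow> complex ^ 'n" where
  "complex_vec p = (\<chi> j. complex_of_real (p $ j))"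

definition strip_product :: "real ^ 'n \<Rightarrow> real ^ 'n \<Rightarrow> (complex ^ 'n) set" where
  "strip_product a b = {w. \<forall>j. a $ j < Re (w $ j) \<and> Re (w $ j) < b $ j}"

definition strip_density :: "real \<Rightarrow> real \<Rightarrow> real \<Rightarrow> real" where
  "strip_density \<alpha> \<beta> x = 2 * (\<beta> - \<alpha>) / pi * sin (pi * (x - \<alpha>) / (\<beta> - \<alpha>))"

definition box_norm :: "real ^ 'n \<Rightarrow> real ^ 'n \<Rightarrow> real ^ 'n \<Rightarrow> real ^ 'n \<Rightarrow> real" where
  "box_norm a b p v = (MAX j. 2 * \<bar>v $ j\<bar> / strip_density (a $ j) (b $ j) (p $ j))"

definition box_distance :: "real ^ 'n \<Rightarrow> real ^ 'n \<Rightarrow> real ^ 'n \<Rightarrow> real ^ 'n \<Rightarrow> real" where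
  "box_distance a b = path_distance (box_norm a b) (box a b)"

end

(*
  Everything is read off the coordinate u = ln (tan (pi (x - a) / (2 (b - a)))). On the strip,
  w |-> tan (pi (w - a) / (2 (b - a))) is a biholomorphism onto the right half plane {Re W > 0},
  whose Kobayashi metric |dW| / (2 Re W) dominates half the differential of ln |W|, with equality
  on the positive axis. By the Schwarz-Pick lemma, u extended to ln |W| therefore changes along a
  holomorphic disk by at most twice the Poincare distance, which gives all the lower bounds, one
  coordinate at a time. For the upper bounds, the disks z |-> W_j = P_j ((1 + z) / (1 - z))^(c_j)
  with |c_j| <= 1 realise any velocity in the unit ball of the metric and join any two real points,
  and the segment in the coordinates u is a shortest curve for the box norm. Thus u is an isometry of
  the box onto R^n with the maximum norm, which is complete.
*)
theory Submission
  imports Defs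
begin

section \<open>Potentials and the length of piecewise C1 curves\<close>

text \<open>\<open>H\<close> acts as a potential: since \<open>F\<close> dominates its differential,
  the fundamental theorem of calculus for \<open>H \<circ> \<gamma>\<close> makes the length at
  least the change of \<open>H\<close>. Integrability is recorded too, because
  \<open>integral\<close> assigns 0 to a nonintegrable function.\<close>

lemma piece_length_bound:
  fixes \<gamma> :: "real \<Rightarrow> 'a::real_normed_vector" and H :: "'a \<Rightarrow> real"
  assumes "s < t"
    and D: "continuous_on {s..t} D"
      "\<And>x. x \<in> {s..t} \<Longrightarrow> (\<gamma> has_vector_derivative D x) (at x within {s..t})"
    and M: "\<gamma> ` {s..t} \<subseteq> M"
    and F: "continuous_on (M \<times> UNIV) (\<lambda>(x, v). F x v)"
    and H: "\<And>x. x \<in> M \<Longrightarrow> (H has_derivative H' x) (at x)"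
    and le: "\<And>x v. x \<in> M \<Longrightarrow> \<bar>H' x v\<bar> \<le> F x v"
  defines "f \<equiv> \<lambda>x. F (\<gamma> x) (vector_derivative \<gamma> (at x))"
  shows "f integrable_on {s..t}" "\<bar>H (\<gamma> t) - H (\<gamma> s)\<bar> \<le> integral {s..t} f"
proof -
  have contg: "continuous_on {s..t} \<gamma>"
    using D(2) by (meson continuous_on_eq_continuous_within has_vector_derivative_continuous)
  have "continuous_on {s..t} (\<lambda>x. (\<lambda>(x, v). F x v) (\<gamma> x, D x))"
    by (rule continuous_on_compose2[OF F]) (use M contg D(1) in \<open>auto intro!: continuous_on_Pair\<close>)
  then have int: "(\<lambda>x. F (\<gamma> x) (D x)) integrable_on {s..t}"
    by (simp add: integrable_continuous_real)
  \<comment> \<open>At \<open>s\<close> and \<open>t\<close> only one-sided derivatives are known,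
    so the two-sided \<open>vector_derivative\<close> is identified with \<open>D\<close> in the
    interior; two points do not affect the integral.\<close>
  have eq: "f x = F (\<gamma> x) (D x)" if "x \<in> {s..t} - {s, t}" for x
  proof -
    have "s < x" "x < t"
      using that by auto
    then have "vector_derivative \<gamma> (at x) = D x"
      using D(2)[of x] by (auto simp: at_within_Icc_at intro: vector_derivative_at)
    then show ?thesis
      by (simp add: f_def)
  qed
  have fin: "finite {s, t}"
    by simp
  have fint: "(f has_integral integral {s..t} (\<lambda>x. F (\<gamma> x) (D x))) {s..t}"
    by (rule has_integral_spike_finite[OF fin eq]) (use int in auto)
  then show "f integrable_on {s..t}"
    by blast
  have "((\<lambda>x. H' (\<gamma> x) (D x)) has_integral (H (\<gamma> t) - H (\<gamma> s))) {s..t}"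
  proof (rule fundamental_theorem_of_calculus)
    show "s \<le> t" using \<open>s < t\<close> by simp
    fix x assume x: "x \<in> {s..t}"
    have "((H \<circ> \<gamma>) has_vector_derivative H' (\<gamma> x) (D x)) (at x within {s..t})"
      using M x
      by (intro vector_derivative_diff_chain_within[OF D(2)[OF x]] has_derivative_at_withinI[OF H]) auto
    then show "((\<lambda>x. H (\<gamma> x)) has_vector_derivative H' (\<gamma> x) (D x)) (at x within {s..t})"
      by (simp add: o_def)
  qed
  moreover from this have "norm (integral {s..t} (\<lambda>x. H' (\<gamma> x) (D x)))
      \<le> integral {s..t} (\<lambda>x. F (\<gamma> x) (D x))"
    using M int
    by (intro Henstock_Kurzweil_Integration.integral_norm_bound_integral)
      (auto simp: image_subset_iff intro!: le)
  ultimately show "\<bar>H (\<gamma> t) - H (\<gamma> s)\<bar> \<le> integral {s..t} f"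
    using fint by (simp add: integral_unique)
qed

text \<open>The bounds for the pieces add up by the triangle inequality, by induction over the
  partition points.\<close>

lemma curve_length_ge:
  fixes \<gamma> :: "real \<Rightarrow> 'a::real_normed_vector" and H :: "'a \<Rightarrow> real"
  assumes \<gamma>: "piecewise_C1_curve \<gamma>" "\<gamma> ` {0..1} \<subseteq> M"
    and F: "continuous_on (M \<times> UNIV) (\<lambda>(x, v). F x v)"
    and H: "\<And>x. x \<in> M \<Longrightarrow> (H has_derivative H' x) (at x)"
    and le: "\<And>x v. x \<in> M \<Longrightarrow> \<bar>H' x v\<bar> \<le> F x v"
  shows "\<bar>H (\<gamma> 1) - H (\<gamma> 0)\<bar> \<le> curve_length F \<gamma>"
proof -
  define f where "f \<equiv> \<lambda>x. F (\<gamma> x) (vector_derivative \<gamma> (at x))"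
  obtain N t where t: "t 0 = 0" "t N = (1::real)"
    and step: "\<And>i. i < N \<Longrightarrow> t i < t (Suc i)"
    and D: "\<And>i. i < N \<Longrightarrow> \<exists>D. continuous_on {t i..t (Suc i)} D \<and>
      (\<forall>s\<in>{t i..t (Suc i)}. (\<gamma> has_vector_derivative D s) (at s within {t i..t (Suc i)}))"
    using \<gamma>(1) unfolding piecewise_C1_curve_def by blast
  have mono: "t i \<le> t j" if "i \<le> j" "j \<le> N" for i j
    using that
  proof (induction j rule: dec_induct)
    case (step j)
    then show ?case using \<open>\<And>i. i < N \<Longrightarrow> t i < t (Suc i)\<close>[of j] by auto
  qed simp
  \<comment> \<open>Integrability is carried through the induction because additivity of the
    integral rests on it.\<close>
  have "f integrable_on {0..t k} \<and> \<bar>H (\<gamma> (t k)) - H (\<gamma> 0)\<bar> \<le> integral {0..t k} f"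
    if "k \<le> N" for k
    using that
  proof (induction k)
    case 0
    then show ?case using t integrable_on_refl[of f 0] by simp
  next
    case (Suc k)
    then have k: "k < N" by simp
    obtain D where D: "continuous_on {t k..t (Suc k)} D"
      "\<And>s. s\<in>{t k..t (Suc k)} \<Longrightarrow> (\<gamma> has_vector_derivative D s) (at s within {t k..t (Suc k)})"
      using D[OF k] by blast
    have bds: "0 \<le> t k" "t (Suc k) \<le> 1" "t k \<le> t (Suc k)"
      using mono[of 0 k] mono[of "Suc k" N] step[of k] t k by auto
    have M: "\<gamma> ` {t k..t (Suc k)} \<subseteq> M"
      using \<gamma>(2) bds by (auto simp: image_subset_iff)
    have piece: "f integrable_on {t k..t (Suc k)}"
        "\<bar>H (\<gamma> (t (Suc k))) - H (\<gamma> (t k))\<bar> \<le> integral {t k..t (Suc k)} f"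
      unfolding f_def by (rule piece_length_bound[OF step[OF k] D M F H le]; assumption)+
    have IH: "f integrable_on {0..t k}" "\<bar>H (\<gamma> (t k)) - H (\<gamma> 0)\<bar> \<le> integral {0..t k} f"
      using Suc by auto
    have int: "f integrable_on {0..t (Suc k)}"
      by (rule Henstock_Kurzweil_Integration.integrable_combine[OF bds(1,3) IH(1) piece(1)])
    then have "integral {0..t k} f + integral {t k..t (Suc k)} f = integral {0..t (Suc k)} f"
      by (rule Henstock_Kurzweil_Integration.integral_combine[OF bds(1,3)])
    then show ?case
      using int IH(2) piece(2) by linarith
  qed
  from this[of N] show ?thesis
    using t by (simp add: curve_length_def f_def)
qed

lemma piecewise_C1_curveI:
  assumes "continuous_on {0..1} D"
    and "\<And>s. s \<in> {0..1} \<Longrightarrow> (\<gamma> has_vector_derivative D s) (at s)"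
  shows "piecewise_C1_curve \<gamma>"
  unfolding piecewise_C1_curve_def
proof (intro exI[of _ "1::nat"] exI[of _ real] conjI)
  have "\<forall>s\<in>{0..1}. (\<gamma> has_vector_derivative D s) (at s within {0..1})"
    using assms(2) by (blast intro: has_vector_derivative_at_within)
  then show "\<forall>i<1. real i < real (Suc i) \<and>
         (\<exists>D. continuous_on {real i..real (Suc i)} D \<and>
              (\<forall>s\<in>{real i..real (Suc i)}.
                 (\<gamma> has_vector_derivative D s) (at s within {real i..real (Suc i)})))"
    using assms(1) by auto
qed auto

lemma curve_length_eq:
  assumes "\<And>s. s \<in> {0..1} \<Longrightarrow> (\<gamma> has_vector_derivative D s) (at s)"
    and "((\<lambda>s. F (\<gamma> s) (D s)) has_integral l) {0..1}"
  shows "curve_length F \<gamma> = l"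
proof -
  have "((\<lambda>s. F (\<gamma> s) (vector_derivative \<gamma> (at s))) has_integral l) {0..1}"
    by (rule has_integral_eq[OF _ assms(2)]) (metis assms(1) vector_derivative_at)
  then show ?thesis
    unfolding curve_length_def by (rule integral_unique)
qed

text \<open>Convexity puts the segment from \<open>p\<close> to \<open>q\<close> into
  \<open>M\<close>, so the infimum is over a nonempty set, and \<open>curve_length_ge\<close> bounds
  each of its members.\<close>

lemma path_distance_ge:
  fixes H :: "'a::real_normed_vector \<Rightarrow> real"
  assumes M: "convex M" "p \<in> M" "q \<in> M"
    and F: "continuous_on (M \<times> UNIV) (\<lambda>(x, v). F x v)"
    and H: "\<And>x. x \<in> M \<Longrightarrow> (H has_derivative H' x) (at x)"
    and le: "\<And>x v. x \<in> M \<Longrightarrow> \<bar>H' x v\<bar> \<le> F x v"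
  shows "\<bar>H q - H p\<bar> \<le> path_distance F M p q"
proof -
  define \<gamma> where "\<gamma> s = (1 - s) *\<^sub>R p + s *\<^sub>R q" for s :: real
  have "(\<gamma> has_vector_derivative q - p) (at s)" for s
    unfolding \<gamma>_def [abs_def]
    by (auto simp: scaleR_left_diff_distrib intro!: derivative_eq_intros)
  then have "piecewise_C1_curve \<gamma>"
    by (intro piecewise_C1_curveI[of "\<lambda>s. q - p"]) auto
  moreover have "\<gamma> ` {0..1} \<subseteq> M"
    using M by (auto simp: \<gamma>_def convex_alt)
  ultimately have "{curve_length F \<gamma> |\<gamma>.
      piecewise_C1_curve \<gamma> \<and> \<gamma> ` {0..1} \<subseteq> M \<and> \<gamma> 0 = p \<and> \<gamma> 1 = q} \<noteq> {}"
    by (auto simp: \<gamma>_def intro!: exI[of _ \<gamma>])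
  moreover have "\<bar>H q - H p\<bar> \<le> l" if "l \<in> {curve_length F \<gamma> |\<gamma>.
      piecewise_C1_curve \<gamma> \<and> \<gamma> ` {0..1} \<subseteq> M \<and> \<gamma> 0 = p \<and> \<gamma> 1 = q}" for l
    using that curve_length_ge[OF _ _ F H le] by blast
  ultimately show ?thesis
    unfolding path_distance_def using M by (simp only: if_True simp_thms cInf_greatest)
qed

lemma path_distance_le:
  assumes \<gamma>: "piecewise_C1_curve \<gamma>" "\<gamma> ` {0..1} \<subseteq> M"
    and F: "continuous_on (M \<times> UNIV) (\<lambda>(x, v). F x v)"
    and nonneg: "\<And>x v. x \<in> M \<Longrightarrow> 0 \<le> F x v"
  shows "path_distance F M (\<gamma> 0) (\<gamma> 1) \<le> curve_length F \<gamma>"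
proof -
  have "\<gamma> 0 \<in> M" "\<gamma> 1 \<in> M"
    using \<gamma>(2) by auto
  \<comment> \<open>The constant potential 0 in \<open>curve_length_ge\<close> shows that lengths
    are nonnegative.\<close>
  moreover have "bdd_below {curve_length F c |c.
      piecewise_C1_curve c \<and> c ` {0..1} \<subseteq> M \<and> c 0 = \<gamma> 0 \<and> c 1 = \<gamma> 1}"
    using curve_length_ge[OF _ _ F, of _ "\<lambda>_. 0" "\<lambda>_ _. 0"] nonneg
    by (intro bdd_belowI[of _ 0]) auto
  ultimately show ?thesis
    using \<gamma> unfolding path_distance_def by (auto intro!: cInf_lower)
qed

section \<open>The Schwarz-Pick lemma for the half plane and the Poincare distance\<close>

text \<open>\<open>f\<close> is \<open>g\<close> followed by the Cayley transform that maps the half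
  plane to the disk and \<open>g 0\<close> to 0. That transform has derivative
  \<open>1 / (2 * Re (g 0))\<close> at \<open>g 0\<close>, so the Schwarz lemma for \<open>f\<close>
  gives the bound.\<close>

lemma Schwarz_half_plane:
  assumes holg: "g holomorphic_on ball 0 1"
    and pos: "\<And>w. w \<in> ball 0 1 \<Longrightarrow> 0 < Re (g w)"
  shows "cmod (deriv g 0) \<le> 2 * Re (g 0)"
proof -
  define f where "f w = (g w - g 0) / (g w + cnj (g 0))" for w
  have g0: "0 < Re (g 0)"
    using pos by simp
  have nz: "g w + cnj (g 0) \<noteq> 0" if "w \<in> ball 0 1" for w
    using pos[OF that] g0 by (auto simp: complex_eq_iff)
  have holf: "f holomorphic_on ball 0 1"
    unfolding f_def using nz by (intro holomorphic_intros holg) auto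
  have "cmod (f w) < 1" if "cmod w < 1" for w
  proof -
    have w: "w \<in> ball 0 1" using that by simp
    \<comment> \<open>The two squares differ by \<open>4 * Re (g w) * Re (g 0)\<close>.\<close>
    have "(cmod (g w - g 0))\<^sup>2 < (cmod (g w + cnj (g 0)))\<^sup>2"
      using pos[OF w] g0 unfolding cmod_power2 by (simp add: power2_eq_square algebra_simps)
    then have "cmod (g w - g 0) < cmod (g w + cnj (g 0))"
      using power_less_imp_less_base norm_ge_zero by blast
    then show ?thesis
      using nz[OF w] by (simp add: f_def norm_divide)
  qed
  then have le: "cmod (deriv f 0) \<le> 1"
    using Schwarz_Lemma(2)[OF holf, of 0] by (simp add: f_def)
  have dg: "(g has_field_derivative deriv g 0) (at 0)"
    using holg by (auto intro: holomorphic_derivI)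
  have sum: "g 0 + cnj (g 0) = of_real (2 * Re (g 0))"
    by (simp add: complex_eq_iff)
  have "(f has_field_derivative deriv g 0 / of_real (2 * Re (g 0))) (at 0)"
    unfolding f_def using nz[of 0] g0
    by (auto intro!: derivative_eq_intros dg simp: sum)
  then have "deriv f 0 = deriv g 0 / of_real (2 * Re (g 0))"
    by (rule DERIV_imp_deriv)
  then show ?thesis
    using le g0 by (simp add: norm_divide norm_mult)
qed

text \<open>The disk automorphism \<open>m\<close> sends 0 to \<open>z\<close> and has derivative
  \<open>1 - |z|^2\<close> at 0; precomposing with it reduces the claim to the centre of the
  disk.\<close>

lemma Schwarz_Pick_half_plane:
  assumes holg: "g holomorphic_on ball 0 1"
    and pos: "\<And>w. w \<in> ball 0 1 \<Longrightarrow> 0 < Re (g w)"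
    and z: "z \<in> ball 0 1"
  shows "cmod (deriv g z) * (1 - (cmod z)\<^sup>2) \<le> 2 * Re (g z)"
proof -
  define m where "m = Moebius_function 0 (- z)"
  have m: "m \<zeta> = (\<zeta> + z) / (1 + cnj z * \<zeta>)" for \<zeta>
    by (simp add: m_def Moebius_function_simple)
  have z1: "cmod (- z) < 1"
    using z by simp
  have maps: "m \<zeta> \<in> ball 0 1" if "\<zeta> \<in> ball 0 1" for \<zeta>
    using Moebius_function_norm_lt_1[OF z1, of \<zeta> 0] that by (simp add: m_def)
  have holm: "m holomorphic_on ball 0 1"
    unfolding m_def by (rule Moebius_function_holomorphic[OF z1])
  have "(g \<circ> m) holomorphic_on ball 0 1"
    by (rule holomorphic_on_compose_gen[OF holm holg]) (use maps in auto)
  then have "cmod (deriv (g \<circ> m) 0) \<le> 2 * Re ((g \<circ> m) 0)"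
    by (rule Schwarz_half_plane) (use maps pos in auto)
  moreover have "deriv (g \<circ> m) 0 = deriv g z * of_real (1 - (cmod z)\<^sup>2)"
  proof (rule DERIV_imp_deriv)
    have "(g has_field_derivative deriv g z) (at (m 0))"
      using holg z by (auto simp: m intro: holomorphic_derivI)
    moreover have "(m has_field_derivative of_real (1 - (cmod z)\<^sup>2)) (at 0)"
      unfolding m using complex_norm_square[of z]
      by (auto intro!: derivative_eq_intros simp: mult.commute)
    ultimately show "(g \<circ> m has_field_derivative deriv g z * of_real (1 - (cmod z)\<^sup>2)) (at 0)"
      by (rule DERIV_chain)
  qed
  moreover have "(cmod z)\<^sup>2 \<le> 1"
    using z by (simp add: power_le_one)
  ultimately show ?thesis
    by (simp add: m norm_mult del: of_real_diff)
qed

lemma continuous_on_poincare_metric: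
  "continuous_on (ball 0 1 \<times> UNIV) (\<lambda>(z, \<xi>). cmod \<xi> / (1 - (cmod z)\<^sup>2))"
  unfolding case_prod_unfold
  by (intro continuous_intros) (auto simp: abs_square_eq_1)

text \<open>The potential is half of \<open>ln |g|\<close>, written with
  \<open>Re (Ln (g z))\<close>. Schwarz-Pick and \<open>Re (g z) \<le> |g z|\<close> bound
  \<open>|g' / g|\<close> by twice the Poincare density.\<close>

lemma poincare_distance_ge:
  assumes holg: "g holomorphic_on ball 0 1"
    and pos: "\<And>w. w \<in> ball 0 1 \<Longrightarrow> 0 < Re (g w)"
    and "\<zeta> \<in> ball 0 1" "\<omega> \<in> ball 0 1"
  shows "\<bar>Re (Ln (g \<omega>)) - Re (Ln (g \<zeta>))\<bar> \<le> 2 * poincare_distance \<zeta> \<omega>"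
proof -
  define H where "H z = Re (Ln (g z)) / 2" for z
  have "\<bar>H \<omega> - H \<zeta>\<bar> \<le> poincare_distance \<zeta> \<omega>"
    unfolding poincare_distance_def
  proof (rule path_distance_ge[OF _ _ _ continuous_on_poincare_metric,
        where H' = "\<lambda>z v. Re (deriv g z / g z * v) / 2"])
    fix z :: complex assume z: "z \<in> ball 0 1"
    have "(g has_field_derivative deriv g z) (at z)"
      using holg z by (auto intro: holomorphic_derivI)
    then have "((\<lambda>z. Ln (g z)) has_field_derivative deriv g z / g z) (at z)"
      using pos[OF z]
      by (auto intro!: derivative_eq_intros simp: complex_nonpos_Reals_iff field_simps)
    then have "((\<lambda>z. Ln (g z)) has_derivative (\<lambda>v. deriv g z / g z * v)) (at z)"
      by (rule has_field_derivative_imp_has_derivative)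
    then show "(H has_derivative (\<lambda>v. Re (deriv g z / g z * v) / 2)) (at z)"
      unfolding H_def by (intro derivative_eq_intros) auto
    fix v
    have z1: "0 < 1 - (cmod z)\<^sup>2"
      using z by (simp add: abs_square_less_1)
    have g: "0 < cmod (g z)"
      using pos[OF z] by auto
    have "cmod (deriv g z) * (1 - (cmod z)\<^sup>2) \<le> 2 * cmod (g z)"
      using Schwarz_Pick_half_plane[OF holg pos z] complex_Re_le_cmod[of "g z"] by linarith
    then have "cmod (deriv g z / g z) \<le> 2 / (1 - (cmod z)\<^sup>2)"
      using z1 g by (simp add: norm_divide field_simps)
    then have "cmod (deriv g z / g z) * cmod v \<le> 2 / (1 - (cmod z)\<^sup>2) * cmod v"
      by (rule mult_right_mono) simp
    moreover have "\<bar>Re (deriv g z / g z * v)\<bar> \<le> cmod (deriv g z / g z) * cmod v"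
      by (metis abs_Re_le_cmod norm_mult)
    ultimately show "\<bar>Re (deriv g z / g z * v) / 2\<bar> \<le> cmod v / (1 - (cmod z)\<^sup>2)"
      by (simp add: mult.commute)
  qed (use assms in auto)
  then show ?thesis
    by (simp add: H_def diff_divide_distrib[symmetric])
qed

text \<open>The radius from 0 to \<open>r\<close>, run through linearly, has hyperbolic length
  \<open>artanh r\<close>.\<close>

lemma poincare_distance_0_le:
  assumes "0 \<le> r" "r < 1"
  shows "poincare_distance 0 (of_real r) \<le> ln ((1 + r) / (1 - r)) / 2"
proof -
  define \<gamma> :: "real \<Rightarrow> complex" where "\<gamma> s = of_real (s * r)" for s
  have d: "(\<gamma> has_vector_derivative of_real r) (at s)" for s
    unfolding \<gamma>_def [abs_def] by (auto intro!: derivative_eq_intros)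
  have lt: "\<bar>s * r\<bar> < 1" if "s \<in> {0..1}" for s
    using that assms mult_left_le_one_le[of r s] by (auto simp: abs_mult)
  have "((\<lambda>s. cmod (of_real r) / (1 - (cmod (\<gamma> s))\<^sup>2)) has_integral
      ln ((1 + 1 * r) / (1 - 1 * r)) / 2 - ln ((1 + 0 * r) / (1 - 0 * r)) / 2) {0..1}"
  proof (rule fundamental_theorem_of_calculus)
    fix s :: real assume s: "s \<in> {0..1}"
    have pos: "0 < 1 + s * r" "0 < 1 - s * r"
      using lt[OF s] by auto
    then have "1 - (s * r)\<^sup>2 = (1 + s * r) * (1 - s * r)" 
      by (simp add: power2_eq_square algebra_simps)
    then have "((\<lambda>s. ln ((1 + s * r) / (1 - s * r)) / 2) has_real_derivative
        r / (1 - (s * r)\<^sup>2)) (at s)"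
      using pos by (auto intro!: derivative_eq_intros simp: divide_simps) (simp add: algebra_simps)
    then show "((\<lambda>s. ln ((1 + s * r) / (1 - s * r)) / 2) has_vector_derivative
        cmod (of_real r) / (1 - (cmod (\<gamma> s))\<^sup>2)) (at s within {0..1})"
      using assms by (simp add: \<gamma>_def has_real_derivative_iff_has_vector_derivative norm_mult
          power_mult_distrib has_vector_derivative_at_within)
  qed simp
  then have "curve_length (\<lambda>z \<xi>. cmod \<xi> / (1 - (cmod z)\<^sup>2)) \<gamma> = ln ((1 + r) / (1 - r)) / 2"
    by (intro curve_length_eq[OF d]) simp
  moreover have "path_distance (\<lambda>z \<xi>. cmod \<xi> / (1 - (cmod z)\<^sup>2)) (ball 0 1) (\<gamma> 0) (\<gamma> 1)
      \<le> curve_length (\<lambda>z \<xi>. cmod \<xi> / (1 - (cmod z)\<^sup>2)) \<gamma>"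
  proof (rule path_distance_le)
    show "piecewise_C1_curve \<gamma>"
      using d by (intro piecewise_C1_curveI[of "\<lambda>_. of_real r"]) auto
    show "\<gamma> ` {0..1} \<subseteq> ball 0 1"
      using lt by (auto simp: \<gamma>_def norm_mult abs_mult)
    show "0 \<le> cmod v / (1 - (cmod z)\<^sup>2)" if "z \<in> ball 0 1" for z v :: complex
      using that by (simp add: abs_square_le_1)
  qed (rule continuous_on_poincare_metric)
  ultimately show ?thesis
    by (simp add: poincare_distance_def \<gamma>_def)
qed

section \<open>The hyperbolic coordinate of an interval and its extension to the strip\<close>

text \<open>Signed arc length, measured from the midpoint of the interval, for the metric
  \<open>2 * |dx| / strip_density \<alpha> \<beta> x\<close>.\<close>

definition strip_coord :: "real \<Rightarrow> real \<Rightarrow> real \<Rightarrow> real" where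
  "strip_coord \<alpha> \<beta> x = ln (tan (pi * (x - \<alpha>) / (2 * (\<beta> - \<alpha>))))"

text \<open>The inverse of \<open>strip_coord \<alpha> \<beta>\<close> when
  \<open>\<alpha> < \<beta>\<close>.\<close>

definition strip_point :: "real \<Rightarrow> real \<Rightarrow> real \<Rightarrow> real" where
  "strip_point \<alpha> \<beta> t = \<alpha> + 2 * (\<beta> - \<alpha>) / pi * arctan (exp t)"

text \<open>For \<open>\<alpha> < \<beta>\<close> this maps the strip biholomorphically onto the
  right half plane, and the real part of its logarithm extends \<open>strip_coord\<close> off the
  real axis.\<close>

definition strip_tan :: "real \<Rightarrow> real \<Rightarrow> complex \<Rightarrow> complex" where
  "strip_tan \<alpha> \<beta> w = tan (of_real (pi / (2 * (\<beta> - \<alpha>))) * (w - of_real \<alpha>))"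

text \<open>The Cayley transform onto the right half plane, then the power \<open>c\<close>, then
  the dilation by \<open>exp t\<close>, then the inverse of \<open>strip_tan\<close>. The centre 0
  goes to \<open>strip_point \<alpha> \<beta> t\<close>.\<close>

definition strip_disk :: "real \<Rightarrow> real \<Rightarrow> real \<Rightarrow> real \<Rightarrow> complex \<Rightarrow> complex" where
  "strip_disk \<alpha> \<beta> t c z = of_real \<alpha> + of_real (2 * (\<beta> - \<alpha>) / pi) *
     Arctan (exp (of_real t + of_real c * Ln ((1 + z) / (1 - z))))"

lemma strip_angle_bounds:
  fixes \<alpha> \<beta> x :: real
  assumes "\<alpha> < x" "x < \<beta>"
  shows "0 < pi * (x - \<alpha>) / (2 * (\<beta> - \<alpha>))" "pi * (x - \<alpha>) / (2 * (\<beta> - \<alpha>)) < pi / 2"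
  using assms by (auto simp: field_simps)

lemma strip_tan_angle_pos:
  fixes \<alpha> \<beta> x :: real
  assumes "\<alpha> < x" "x < \<beta>"
  shows "0 < tan (pi * (x - \<alpha>) / (2 * (\<beta> - \<alpha>)))"
  using strip_angle_bounds[OF assms] by (rule tan_gt_zero)

text \<open>Double angle formula: the sine in the density has twice the angle of the tangent in
  \<open>strip_coord\<close>.\<close>

lemma strip_density_eq:
  fixes \<alpha> \<beta> x :: real
  defines "\<theta> \<equiv> pi * (x - \<alpha>) / (2 * (\<beta> - \<alpha>))"
  assumes "\<alpha> < \<beta>"
  shows "strip_density \<alpha> \<beta> x = 4 * (\<beta> - \<alpha>) / pi * (sin \<theta> * cos \<theta>)"
proof -
  have "pi * (x - \<alpha>) / (\<beta> - \<alpha>) = 2 * \<theta>"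
    using assms by (simp add: field_simps)
  then show ?thesis
    by (simp add: strip_density_def sin_double)
qed

lemma strip_density_pos:
  assumes "\<alpha> < x" "x < \<beta>"
  shows "0 < strip_density \<alpha> \<beta> x"
proof -
  define \<theta> where "\<theta> = pi * (x - \<alpha>) / (2 * (\<beta> - \<alpha>))"
  have \<theta>: "0 < \<theta>" "\<theta> < pi / 2"
    unfolding \<theta>_def using strip_angle_bounds[OF assms] .
  then have "0 < sin \<theta> * cos \<theta>"
    by (intro mult_pos_pos sin_gt_zero2 cos_gt_zero_pi) auto
  then have "0 < 4 * (\<beta> - \<alpha>) / pi * (sin \<theta> * cos \<theta>)"
    using assms by (intro mult_pos_pos[of "4 * (\<beta> - \<alpha>) / pi"]) auto
  then show ?thesis
    using assms by (simp only: strip_density_eq \<theta>_def)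
qed

text \<open>The derivative of \<open>ln (tan y)\<close> is \<open>1 / (sin y * cos y)\<close>, which
  is the reciprocal of the double angle form of the density up to a constant.\<close>

lemma strip_coord_has_derivative:
  assumes "\<alpha> < x" "x < \<beta>"
  shows "(strip_coord \<alpha> \<beta> has_real_derivative 2 / strip_density \<alpha> \<beta> x) (at x)"
proof -
  define \<theta> where "\<theta> = pi * (x - \<alpha>) / (2 * (\<beta> - \<alpha>))"
  have \<theta>: "0 < \<theta>" "\<theta> < pi / 2"
    unfolding \<theta>_def using strip_angle_bounds[OF assms] .
  have nz: "cos \<theta> \<noteq> 0" "sin \<theta> \<noteq> 0"
    using \<theta> cos_gt_zero_pi[of \<theta>] sin_gt_zero2[of \<theta>] by auto
  have "((\<lambda>x. pi * (x - \<alpha>) / (2 * (\<beta> - \<alpha>))) has_real_derivative pi / (2 * (\<beta> - \<alpha>))) (at x)"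
    using assms by (auto intro!: derivative_eq_intros)
  moreover have "((\<lambda>y. ln (tan y)) has_real_derivative 1 / (sin \<theta> * cos \<theta>)) (at \<theta>)"
    using nz tan_gt_zero[OF \<theta>]
    by (auto intro!: derivative_eq_intros simp: tan_def field_simps power2_eq_square)
  ultimately have "((\<lambda>x. ln (tan (pi * (x - \<alpha>) / (2 * (\<beta> - \<alpha>))))) has_real_derivative
      1 / (sin \<theta> * cos \<theta>) * (pi / (2 * (\<beta> - \<alpha>)))) (at x)"
    unfolding \<theta>_def by (rule DERIV_chain2[rotated])
  moreover have "1 / y * (pi / (2 * l)) = 2 / (4 * l / pi * y)" for l y :: real
    by simp
  ultimately show ?thesis
    using assms unfolding strip_coord_def[abs_def] \<theta>_def by (simp only: strip_density_eq)
qed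

lemma strip_scale_bounds:
  fixes \<alpha> \<beta> y :: real
  assumes "\<alpha> < \<beta>" "0 < y" "y < pi / 2"
  shows "\<alpha> < \<alpha> + 2 * (\<beta> - \<alpha>) / pi * y" "\<alpha> + 2 * (\<beta> - \<alpha>) / pi * y < \<beta>"
proof -
  have "0 < 2 * (\<beta> - \<alpha>) / pi"
    using assms by simp
  then have "0 < 2 * (\<beta> - \<alpha>) / pi * y" "2 * (\<beta> - \<alpha>) / pi * y < 2 * (\<beta> - \<alpha>) / pi * (pi / 2)"
    using assms by (blast intro: mult_pos_pos mult_strict_left_mono)+
  then show "\<alpha> < \<alpha> + 2 * (\<beta> - \<alpha>) / pi * y" "\<alpha> + 2 * (\<beta> - \<alpha>) / pi * y < \<beta>"
    by simp_all
qed

lemma strip_point_bounds: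
  assumes "\<alpha> < \<beta>"
  shows "\<alpha> < strip_point \<alpha> \<beta> t" "strip_point \<alpha> \<beta> t < \<beta>"
proof -
  have "0 < arctan (exp t)" "arctan (exp t) < pi / 2"
    using arctan_ubound[of "exp t"] by (simp_all only: zero_less_arctan_iff exp_gt_zero)
  then show "\<alpha> < strip_point \<alpha> \<beta> t" "strip_point \<alpha> \<beta> t < \<beta>"
    unfolding strip_point_def using strip_scale_bounds[OF assms] by blast+
qed

lemma strip_coord_point: "\<alpha> < \<beta> \<Longrightarrow> strip_coord \<alpha> \<beta> (strip_point \<alpha> \<beta> t) = t"
  by (simp add: strip_coord_def strip_point_def tan_arctan)

lemma strip_point_coord:
  assumes "\<alpha> < x" "x < \<beta>"
  shows "strip_point \<alpha> \<beta> (strip_coord \<alpha> \<beta> x) = x"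
proof -
  define \<theta> where "\<theta> = pi * (x - \<alpha>) / (2 * (\<beta> - \<alpha>))"
  have "0 < \<theta>" "\<theta> < pi / 2"
    unfolding \<theta>_def using strip_angle_bounds[OF assms] .
  then have "arctan (exp (ln (tan \<theta>))) = \<theta>"
    by (simp add: tan_gt_zero arctan_tan)
  then have "strip_point \<alpha> \<beta> (strip_coord \<alpha> \<beta> x) = \<alpha> + 2 * (\<beta> - \<alpha>) / pi * \<theta>"
    by (simp add: strip_coord_def strip_point_def \<theta>_def)
  then show ?thesis
    using assms by (simp add: \<theta>_def)
qed

text \<open>For an angle with tangent \<open>x = exp t\<close>, the product of sine and cosine is
  \<open>x / (1 + x^2)\<close>.\<close>

lemma strip_density_point:
  assumes "\<alpha> < \<beta>"
  shows "strip_density \<alpha> \<beta> (strip_point \<alpha> \<beta> t) = 4 * (\<beta> - \<alpha>) / pi * (exp t / (1 + (exp t)\<^sup>2))"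
proof -
  have "pi * (strip_point \<alpha> \<beta> t - \<alpha>) / (2 * (\<beta> - \<alpha>)) = arctan (exp t)"
    using assms by (simp add: strip_point_def)
  then show ?thesis
    using assms by (simp add: strip_density_eq sin_arctan cos_arctan)
qed

lemma strip_point_has_derivative:
  assumes "\<alpha> < \<beta>"
  shows "(strip_point \<alpha> \<beta> has_real_derivative strip_density \<alpha> \<beta> (strip_point \<alpha> \<beta> t) / 2) (at t)"
proof -
  have "(strip_point \<alpha> \<beta> has_real_derivative
      2 * (\<beta> - \<alpha>) / pi * (inverse (1 + (exp t)\<^sup>2) * exp t)) (at t)"
    unfolding strip_point_def[abs_def]
    by (rule DERIV_cmult[THEN DERIV_add[OF DERIV_const], simplified]
        DERIV_chain2[OF DERIV_arctan DERIV_exp])+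
  moreover have "2 * l / pi * (inverse (1 + e\<^sup>2) * e) = 4 * l / pi * (e / (1 + e\<^sup>2)) / 2"
    for l e :: real
    by (simp add: inverse_eq_divide)
  ultimately show ?thesis
    unfolding strip_density_point[OF assms] by (simp only:)
qed

text \<open>\<open>Re (tan z)\<close> has the sign of \<open>Re (sin z * cnj (cos z))\<close>, in
  which the exponentials of \<open>Im z\<close> cancel and \<open>sin (Re z) * cos (Re z)\<close>
  remains.\<close>

lemma Re_tan_pos:
  assumes "0 < Re z" "Re z < pi / 2"
  shows "cos z \<noteq> 0" "0 < Re (tan z)"
proof -
  have c: "0 < cos (Re z)" and s: "0 < sin (Re z)"
    using assms by (auto intro: cos_gt_zero_pi sin_gt_zero2)
  have "0 < exp (Im z) + exp (- Im z)"
    by (simp add: add_pos_pos)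
  then have "Re (cos z) \<noteq> 0"
    using c by (simp add: Re_cos)
  then show nz: "cos z \<noteq> 0"
    by auto
  have "Re (sin z) * Re (cos z) + Im (sin z) * Im (cos z) =
      sin (Re z) * cos (Re z) * (exp (Im z) * exp (- Im z))"
    by (simp add: Re_sin Re_cos Im_sin Im_cos field_simps)
  then have "0 < Re (sin z) * Re (cos z) + Im (sin z) * Im (cos z)"
    using c s by (simp add: exp_minus)
  then show "0 < Re (tan z)"
    unfolding tan_def Re_divide' using nz by (intro divide_pos_pos) auto
qed

lemma strip_tan_bounds:
  assumes "\<alpha> < Re w" "Re w < \<beta>"
  shows "cos (of_real (pi / (2 * (\<beta> - \<alpha>))) * (w - of_real \<alpha>)) \<noteq> 0"
    and "0 < Re (strip_tan \<alpha> \<beta> w)"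
proof -
  define z where "z = of_real (pi / (2 * (\<beta> - \<alpha>))) * (w - of_real \<alpha>)"
  have "Re z = pi * (Re w - \<alpha>) / (2 * (\<beta> - \<alpha>))"
    by (simp add: z_def del: of_real_divide)
  then have "0 < Re z" "Re z < pi / 2"
    using strip_angle_bounds[OF assms] by simp_all
  from Re_tan_pos[OF this] show "cos (of_real (pi / (2 * (\<beta> - \<alpha>))) * (w - of_real \<alpha>)) \<noteq> 0"
    and "0 < Re (strip_tan \<alpha> \<beta> w)"
    unfolding z_def strip_tan_def .
qed

lemma strip_tan_of_real:
  "strip_tan \<alpha> \<beta> (of_real x) = of_real (tan (pi * (x - \<alpha>) / (2 * (\<beta> - \<alpha>))))"
  by (simp only: strip_tan_def of_real_diff[symmetric] of_real_mult[symmetric]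
      tan_of_real[symmetric] times_divide_eq_left)

lemma strip_tan_holomorphic:
  "strip_tan \<alpha> \<beta> holomorphic_on {w. \<alpha> < Re w \<and> Re w < \<beta>}"
  unfolding strip_tan_def[abs_def] tan_def
  by (intro holomorphic_intros) (use strip_tan_bounds(1) in auto)

section \<open>Lower bounds: arbitrary holomorphic disks in a strip\<close>

text \<open>Apply the Schwarz lemma to \<open>strip_tan \<alpha> \<beta> \<circ> f\<close>. Its
  derivative at 0 has modulus \<open>l * |f'(0)| / (cos \<theta>)^2\<close>; solving for
  \<open>|f'(0)|\<close> leaves \<open>2 * sin \<theta> * cos \<theta> / l\<close>, which is the
  density.\<close>

lemma strip_disk_derivative_le:
  assumes hol: "f holomorphic_on ball 0 1"
    and strip: "\<And>z. z \<in> ball 0 1 \<Longrightarrow> \<alpha> < Re (f z) \<and> Re (f z) < \<beta>"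
    and f0: "f 0 = of_real x"
  shows "cmod (deriv f 0) \<le> strip_density \<alpha> \<beta> x"
proof -
  have x: "\<alpha> < x" "x < \<beta>"
    using strip[of 0] f0 by auto
  define \<theta> where "\<theta> = pi * (x - \<alpha>) / (2 * (\<beta> - \<alpha>))"
  define l where "l = pi / (2 * (\<beta> - \<alpha>))"
  have \<theta>: "0 < \<theta>" "\<theta> < pi / 2"
    unfolding \<theta>_def using strip_angle_bounds[OF x] .
  have c: "0 < cos \<theta>"
    using \<theta> cos_gt_zero_pi[of \<theta>] by auto
  have l: "0 < l"
    using x by (simp add: l_def)
  have "(strip_tan \<alpha> \<beta> \<circ> f) holomorphic_on ball 0 1"
    by (rule holomorphic_on_compose_gen[OF hol strip_tan_holomorphic]) (use strip in auto)
  then have "cmod (deriv (strip_tan \<alpha> \<beta> \<circ> f) 0) \<le> 2 * Re ((strip_tan \<alpha> \<beta> \<circ> f) 0)"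
    by (rule Schwarz_half_plane) (use strip strip_tan_bounds(2) in auto)
  also have "(strip_tan \<alpha> \<beta> \<circ> f) 0 = of_real (tan \<theta>)"
    by (simp add: f0 strip_tan_of_real \<theta>_def)
  finally have le: "cmod (deriv (strip_tan \<alpha> \<beta> \<circ> f) 0) \<le> 2 * tan \<theta>"
    by (simp add: o_def)
  have arg: "of_real l * (f 0 - of_real \<alpha>) = of_real \<theta>"
    by (simp add: f0 l_def \<theta>_def)
  have df: "(f has_field_derivative deriv f 0) (at 0)"
    using hol by (auto intro: holomorphic_derivI)
  have "((\<lambda>z. tan (of_real l * (f z - of_real \<alpha>))) has_field_derivative
      inverse ((cos (of_real l * (f 0 - of_real \<alpha>)))\<^sup>2) * (of_real l * deriv f 0)) (at 0)"
    by (rule DERIV_chain2[OF DERIV_tan]) 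
      (use c in \<open>auto simp: arg cos_of_real intro!: derivative_eq_intros df\<close>)
  then have "deriv (strip_tan \<alpha> \<beta> \<circ> f) 0 = inverse ((of_real (cos \<theta>))\<^sup>2) * (of_real l * deriv f 0)"
    unfolding strip_tan_def l_def[symmetric] o_def arg cos_of_real by (rule DERIV_imp_deriv)
  then have "cmod (deriv (strip_tan \<alpha> \<beta> \<circ> f) 0) = l * cmod (deriv f 0) / (cos \<theta>)\<^sup>2"
    using l by (simp add: norm_mult norm_inverse norm_power divide_inverse)
  with le have "l * cmod (deriv f 0) / (cos \<theta>)\<^sup>2 \<le> 2 * tan \<theta>"
    by simp
  then have "cmod (deriv f 0) \<le> 2 * tan \<theta> * (cos \<theta>)\<^sup>2 / l"
    using c l by (simp add: pos_divide_le_eq pos_le_divide_eq mult.commute)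
  also have "\<dots> = 2 * (sin \<theta> * cos \<theta>) / l"
    using c by (simp add: tan_def power2_eq_square)
  also have "\<dots> = strip_density \<alpha> \<beta> x"
  proof -
  have "2 * y / (pi / (2 * d)) = 4 * d / pi * y" for d y :: real
    by simp
  then show ?thesis
    using x by (simp only: strip_density_eq \<theta>_def l_def)
  qed
  finally show ?thesis .
qed

text \<open>The estimate for one link of a Kobayashi chain, whose end points may be any complex
  points of the strip.\<close>

lemma strip_disk_log_bound:
  assumes hol: "f holomorphic_on ball 0 1"
    and strip: "\<And>z. z \<in> ball 0 1 \<Longrightarrow> \<alpha> < Re (f z) \<and> Re (f z) < \<beta>"
    and "\<zeta> \<in> ball 0 1" "\<omega> \<in> ball 0 1"
  shows "\<bar>Re (Ln (strip_tan \<alpha> \<beta> (f \<omega>))) - Re (Ln (strip_tan \<alpha> \<beta> (f \<zeta>)))\<bar>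
    \<le> 2 * poincare_distance \<zeta> \<omega>"
proof -
  have "(strip_tan \<alpha> \<beta> \<circ> f) holomorphic_on ball 0 1"
    by (rule holomorphic_on_compose_gen[OF hol strip_tan_holomorphic]) (use strip in auto)
  from poincare_distance_ge[OF this _ assms(3,4)] show ?thesis
    using strip strip_tan_bounds(2) by auto
qed

lemma Ln_strip_tan_of_real:
  assumes "\<alpha> < x" "x < \<beta>"
  shows "Ln (strip_tan \<alpha> \<beta> (of_real x)) = of_real (strip_coord \<alpha> \<beta> x)"
  using strip_tan_angle_pos[OF assms] by (simp add: strip_tan_of_real strip_coord_def Ln_of_real)

section \<open>Upper bounds: the extremal disks in a strip\<close>

text \<open>\<open>Arctan w\<close> is \<open>\<i> / 2 * Ln v\<close>. For \<open>Re w > 0\<close>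
  the quotient \<open>v\<close> lies in the lower half plane, so \<open>Ln v\<close> has negative
  imaginary part.\<close>

lemma Re_Arctan_pos:
  assumes "0 < Re w"
  shows "0 < Re (Arctan w)"
proof -
  define v where "v = (1 - \<i> * w) / (1 + \<i> * w)"
  have nz: "1 + \<i> * w \<noteq> 0" "1 - \<i> * w \<noteq> 0"
    using assms by (auto simp: complex_eq_iff)
  have "Im v < 0"
    using nz(1) assms
    by (simp add: v_def Im_divide' divide_less_0_iff cmod_power2 algebra_simps
        add_pos_nonneg)
  then have "Im (Ln v) < 0"
    using nz Im_Ln_pos_le[of v] Im_Ln_le_pi[of v] by (force simp: v_def)
  then show ?thesis
    by (simp add: Arctan_def v_def)
qed

lemma Re_Cayley_pos:
  assumes "z \<in> ball 0 1"
  shows "1 - z \<noteq> 0" "0 < Re ((1 + z) / (1 - z))"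
proof -
  show nz: "1 - z \<noteq> 0"
    using assms by auto
  have "(Re z)\<^sup>2 + (Im z)\<^sup>2 < 1"
    using assms by (simp add: abs_square_less_1 flip: cmod_power2)
  then show "0 < Re ((1 + z) / (1 - z))"
    using nz by (simp add: Re_divide' zero_less_divide_iff cmod_power2 algebra_simps power2_eq_square)
qed

text \<open>The Cayley transform has argument below \<open>pi / 2\<close> in modulus, and a power
  \<open>c\<close> with \<open>|c| \<le> 1\<close> does not enlarge it.\<close>

lemma Re_exp_Cayley_pos:
  assumes c: "\<bar>c\<bar> \<le> 1" and z: "z \<in> ball 0 1"
  shows "0 < Re (exp (of_real t + of_real c * Ln ((1 + z) / (1 - z))))"
proof -
  have "(1 + z) / (1 - z) \<noteq> 0"
    using Re_Cayley_pos[OF z] by fastforce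
  then have "\<bar>Im (Ln ((1 + z) / (1 - z)))\<bar> < pi / 2"
    using Re_Cayley_pos(2)[OF z] by (rule Re_Ln_pos_lt[THEN iffD2])
  moreover have "\<bar>c\<bar> * \<bar>Im (Ln ((1 + z) / (1 - z)))\<bar> \<le> 1 * \<bar>Im (Ln ((1 + z) / (1 - z)))\<bar>"
    using c by (intro mult_right_mono) auto
  ultimately have "\<bar>c * Im (Ln ((1 + z) / (1 - z)))\<bar> < pi / 2"
    by (simp add: abs_mult)
  then have "0 < cos (c * Im (Ln ((1 + z) / (1 - z))))"
    by (intro cos_gt_zero_pi) auto
  then show ?thesis
    by (simp add: Re_exp)
qed

lemma strip_disk_holomorphic:
  assumes c: "\<bar>c\<bar> \<le> 1"
  shows "strip_disk \<alpha> \<beta> t c holomorphic_on ball 0 1"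
proof -
  have "(1 + z) / (1 - z) \<notin> \<real>\<^sub>\<le>\<^sub>0" if "z \<in> ball 0 1" for z :: complex
    unfolding complex_nonpos_Reals_iff using Re_Cayley_pos(2)[OF that] by linarith
  then have "(\<lambda>z. exp (of_real t + of_real c * Ln ((1 + z) / (1 - z)))) holomorphic_on ball 0 1"
    using Re_Cayley_pos(1) by (intro holomorphic_intros)
  moreover have "Arctan holomorphic_on {w. 0 < Re w}"
    by (rule holomorphic_on_Arctan) auto
  ultimately have "(Arctan \<circ> (\<lambda>z. exp (of_real t + of_real c * Ln ((1 + z) / (1 - z)))))
      holomorphic_on ball 0 1"
    using Re_exp_Cayley_pos[OF c] by (intro holomorphic_on_compose_gen) auto
  then show ?thesis
    unfolding strip_disk_def[abs_def] o_def by (intro holomorphic_intros)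
qed

lemma strip_disk_bounds:
  assumes "\<alpha> < \<beta>" "\<bar>c\<bar> \<le> 1" "z \<in> ball 0 1"
  shows "\<alpha> < Re (strip_disk \<alpha> \<beta> t c z) \<and> Re (strip_disk \<alpha> \<beta> t c z) < \<beta>"
proof -
  define w where "w = exp (of_real t + of_real c * Ln ((1 + z) / (1 - z)))"
  define y where "y = Re (Arctan w)"
  have "0 < Re w"
    unfolding w_def using assms Re_exp_Cayley_pos by blast
  then have "0 < y" "y < pi / 2"
    using Re_Arctan_pos[of w] Re_Arctan_bounds[of w] by (auto simp: y_def)
  moreover have "Re (strip_disk \<alpha> \<beta> t c z) = \<alpha> + 2 * (\<beta> - \<alpha>) / pi * y"
    unfolding strip_disk_def y_def w_def by (simp del: of_real_divide of_real_mult of_real_diff)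
  ultimately show ?thesis
    using strip_scale_bounds[OF assms(1)] by simp
qed

text \<open>On the real diameter the disk stays real and its hyperbolic coordinate grows with slope
  \<open>c\<close> against \<open>ln ((1 + r) / (1 - r))\<close>, twice the signed Poincare arc
  length from 0.\<close>

lemma strip_disk_of_real:
  assumes "\<bar>r\<bar> < 1"
  shows "strip_disk \<alpha> \<beta> t c (of_real r) =
    of_real (strip_point \<alpha> \<beta> (t + c * ln ((1 + r) / (1 - r))))"
proof -
  have r: "0 < (1 + r) / (1 - r)"
    using assms by auto
  have "Ln ((1 + of_real r) / (1 - of_real r)) = Ln (of_real ((1 + r) / (1 - r)))"
    by simp
  also have "\<dots> = of_real (ln ((1 + r) / (1 - r)))"
    using r by (simp only: Ln_of_real)
  finally have "strip_disk \<alpha> \<beta> t c (of_real r) = of_real \<alpha> + of_real (2 * (\<beta> - \<alpha>) / pi) *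
      Arctan (of_real (exp (t + c * ln ((1 + r) / (1 - r)))))"
    by (simp only: strip_disk_def exp_of_real of_real_add[symmetric] of_real_mult[symmetric])
  then show ?thesis
    by (simp add: Arctan_of_real strip_point_def)
qed

text \<open>The derivative 2 of \<open>Ln ((1 + z) / (1 - z))\<close> at 0 cancels the one half in
  the derivative of \<open>strip_point\<close>. Slopes \<open>c\<close> in \<open>[-1, 1]\<close>
  thus give every real velocity up to the density in modulus.\<close>

lemma deriv_strip_disk_0:
  assumes "\<alpha> < \<beta>"
  shows "deriv (strip_disk \<alpha> \<beta> t c) 0 = of_real (c * strip_density \<alpha> \<beta> (strip_point \<alpha> \<beta> t))"
proof (rule DERIV_imp_deriv)
  have "((\<lambda>z. Ln ((1 + z) / (1 - z))) has_field_derivative 2) (at 0)"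
    by (auto intro!: derivative_eq_intros)
  then have "((\<lambda>z. exp (of_real t + of_real c * Ln ((1 + z) / (1 - z)))) has_field_derivative
      of_real (2 * c * exp t)) (at 0)"
    by (auto intro!: derivative_eq_intros simp: exp_of_real)
  moreover have "(Arctan has_field_derivative of_real (inverse (1 + (exp t)\<^sup>2)))
      (at (exp (of_real t + of_real c * Ln ((1 + 0) / (1 - 0)))))"
    using has_field_derivative_Arctan[of "of_real (exp t)"] by (simp add: exp_of_real)
  ultimately have "((\<lambda>z. Arctan (exp (of_real t + of_real c * Ln ((1 + z) / (1 - z)))))
      has_field_derivative of_real (inverse (1 + (exp t)\<^sup>2)) * of_real (2 * c * exp t)) (at 0)"
    by (rule DERIV_chain2[rotated])
  from DERIV_add[OF DERIV_const[of "of_real \<alpha>"]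
      DERIV_cmult[OF this, of "of_real (2 * (\<beta> - \<alpha>) / pi)"]]
  have "(strip_disk \<alpha> \<beta> t c has_field_derivative of_real (2 * (\<beta> - \<alpha>) / pi) *
      (of_real (inverse (1 + (exp t)\<^sup>2)) * of_real (2 * c * exp t))) (at 0)"
    unfolding strip_disk_def[abs_def] by (simp only: add_0)
  moreover have "2 * (\<beta> - \<alpha>) / pi * (inverse (1 + (exp t)\<^sup>2) * (2 * c * exp t)) =
      c * strip_density \<alpha> \<beta> (strip_point \<alpha> \<beta> t)"
    by (simp add: strip_density_point[OF assms] field_simps)
  ultimately show "(strip_disk \<alpha> \<beta> t c has_field_derivative
      of_real (c * strip_density \<alpha> \<beta> (strip_point \<alpha> \<beta> t))) (at 0)"
    by (simp only: of_real_mult[symmetric])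
qed

section \<open>Finite maxima and attained infima\<close>

lemma MAX_upper:
  fixes f :: "'n::finite \<Rightarrow> real"
  shows "f j \<le> (MAX j. f j)"
  by simp

lemma MAX_attained:
  fixes f :: "'n::finite \<Rightarrow> real"
  obtains j where "(MAX j. f j) = f j"
proof -
  have "(MAX j. f j) \<in> range f"
    by (rule Max_in) auto
  then show ?thesis
    using that by blast
qed

lemma continuous_on_MAX:
  fixes f :: "'i \<Rightarrow> 'a::topological_space \<Rightarrow> real"
  assumes "finite I" "I \<noteq> {}" "\<And>i. i \<in> I \<Longrightarrow> continuous_on S (f i)"
  shows "continuous_on S (\<lambda>x. MAX i\<in>I. f i x)"
  using assms
proof (induction rule: finite_ne_induct)
  case (insert i I)
  then show ?case
    by (simp add: continuous_on_max)
qed simp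

text \<open>The lower bound forces \<open>x = m\<close>, so an upper estimate for the witness is
  enough.\<close>

lemma cInf_eq_attained:
  fixes m :: real
  assumes "x \<in> S" "x \<le> m" "\<And>y. y \<in> S \<Longrightarrow> m \<le> y"
  shows "Inf S = m"
  using assms by (intro cInf_eq_minimum) force+

section \<open>The box norm and its path distance\<close>

context
  fixes a b :: "real ^ 'n"
  assumes ab: "\<forall>j. a $ j < b $ j"
begin

lemma continuous_on_box_norm:
  "continuous_on (box a b \<times> UNIV) (\<lambda>(p, v). box_norm a b p v)"
  unfolding box_norm_def case_prod_unfold
proof (rule continuous_on_MAX)
  fix j :: 'n
  have ab_j: "b $ j - a $ j \<noteq> 0"
    using ab by (metis less_irrefl right_minus_eq)
  have "strip_density (a $ j) (b $ j) (p $ j) \<noteq> 0" if "p \<in> box a b" for p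
    using that strip_density_pos[of "a $ j" "p $ j" "b $ j"] by (auto simp: mem_box_cart)
  then show "continuous_on (box a b \<times> UNIV)
      (\<lambda>x. 2 * \<bar>snd x $ j\<bar> / strip_density (a $ j) (b $ j) (fst x $ j))"
    using ab_j unfolding strip_density_def by (intro continuous_intros) auto
qed auto

lemma box_norm_nonneg: "p \<in> box a b \<Longrightarrow> 0 \<le> box_norm a b p v"
proof -
  assume "p \<in> box a b"
  then have "0 \<le> 2 * \<bar>v $ j\<bar> / strip_density (a $ j) (b $ j) (p $ j)" for j
    using strip_density_pos[of "a $ j" "p $ j" "b $ j"] by (simp add: mem_box_cart)
  then show ?thesis
    unfolding box_norm_def by (meson MAX_upper order_trans)
qed

text \<open>The hyperbolic coordinate of the \<open>j\<close>-th component is a potential: the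
  modulus of its differential is one of the terms in the maximum that defines
  \<open>box_norm\<close>.\<close>

lemma box_distance_ge:
  assumes p: "p \<in> box a b" and q: "q \<in> box a b"
  shows "\<bar>strip_coord (a $ j) (b $ j) (q $ j) - strip_coord (a $ j) (b $ j) (p $ j)\<bar>
    \<le> box_distance a b p q"
  unfolding box_distance_def
proof (rule path_distance_ge[OF convex_box(2) p q continuous_on_box_norm,
      where H' = "\<lambda>x v. v $ j * (2 / strip_density (a $ j) (b $ j) (x $ j))"])
  fix x assume x: "x \<in> box a b"
  then have xj: "a $ j < x $ j" "x $ j < b $ j"
    by (auto simp: mem_box_cart)
  have "((\<lambda>x. x $ j) has_derivative (\<lambda>v. v $ j)) (at x)"
    by (intro bounded_linear.has_derivative[OF bounded_linear_vec_nth] has_derivative_ident)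
  moreover have "(strip_coord (a $ j) (b $ j) has_derivative
      (\<lambda>h. h * (2 / strip_density (a $ j) (b $ j) (x $ j)))) (at (x $ j))"
    using strip_coord_has_derivative[OF xj] unfolding has_field_derivative_def mult_commute_abs .
  ultimately show "((\<lambda>x. strip_coord (a $ j) (b $ j) (x $ j)) has_derivative
      (\<lambda>v. v $ j * (2 / strip_density (a $ j) (b $ j) (x $ j)))) (at x)"
    by (rule has_derivative_compose)
  fix v :: "real ^ 'n"
  have "\<bar>v $ j * (2 / strip_density (a $ j) (b $ j) (x $ j))\<bar> =
      2 * \<bar>v $ j\<bar> / strip_density (a $ j) (b $ j) (x $ j)"
    using strip_density_pos[OF xj] by (simp add: abs_mult)
  also have "\<dots> \<le> box_norm a b x v"
    unfolding box_norm_def by (rule MAX_upper)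
  finally show "\<bar>v $ j * (2 / strip_density (a $ j) (b $ j) (x $ j))\<bar> \<le> box_norm a b x v" .
qed

text \<open>The segment between the hyperbolic coordinates of \<open>p\<close> and \<open>q\<close>,
  carried back to the box, has exactly this length.\<close>

lemma box_distance_le:
  assumes p: "p \<in> box a b" and q: "q \<in> box a b"
  shows "box_distance a b p q \<le>
    (MAX j. \<bar>strip_coord (a $ j) (b $ j) (q $ j) - strip_coord (a $ j) (b $ j) (p $ j)\<bar>)"
proof -
  define u where "u x j = strip_coord (a $ j) (b $ j) (x $ j)" for x :: "real ^ 'n" and j
  define \<gamma> :: "real \<Rightarrow> real ^ 'n" where
    "\<gamma> s = (\<chi> j. strip_point (a $ j) (b $ j) (u p j + s * (u q j - u p j)))" for s
  define D :: "real \<Rightarrow> real ^ 'n" where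
    "D s = (\<chi> j. strip_density (a $ j) (b $ j) (\<gamma> s $ j) / 2 * (u q j - u p j))" for s
  have in_box: "\<gamma> s \<in> box a b" for s
    using strip_point_bounds ab by (auto simp: \<gamma>_def mem_box_cart)
  have d_j: "((\<lambda>s. \<gamma> s $ j) has_vector_derivative D s $ j) (at s)" for s j
  proof -
    have "((\<lambda>s. u p j + s * (u q j - u p j)) has_real_derivative u q j - u p j) (at s)"
      by (auto intro!: derivative_eq_intros)
    from DERIV_chain2[OF strip_point_has_derivative[OF ab[rule_format]] this, of j]
    show ?thesis
      by (simp add: \<gamma>_def D_def has_real_derivative_iff_has_vector_derivative)
  qed
  have d: "(\<gamma> has_vector_derivative D s) (at s)" for s
    using d_j
    by (simp add: has_vector_derivative_def has_derivative_componentwise_within[of \<gamma>]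
        Basis_vec_def inner_axis)
  have contD: "continuous_on {0..1} D"
  proof -
    have "continuous_on {0..1} \<gamma>"
      using d by (meson continuous_at_imp_continuous_on has_vector_derivative_continuous)
    then show ?thesis
      unfolding D_def strip_density_def using ab
      by (intro continuous_intros) (auto simp: less_imp_neq[symmetric])
  qed
  have "curve_length (box_norm a b) \<gamma> = (MAX j. \<bar>u q j - u p j\<bar>)"
  proof (rule curve_length_eq[OF d])
    \<comment> \<open>The density in \<open>D\<close> cancels the one in \<open>box_norm\<close>, so
      the speed is constant.\<close>
    have "box_norm a b (\<gamma> s) (D s) = (MAX j. \<bar>u q j - u p j\<bar>)" for s
    proof -
      have "2 * \<bar>D s $ j\<bar> / strip_density (a $ j) (b $ j) (\<gamma> s $ j) = \<bar>u q j - u p j\<bar>" for j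
        using in_box[of s] strip_density_pos[of "a $ j" "\<gamma> s $ j" "b $ j"]
        by (simp add: D_def abs_mult mem_box_cart)
      then show ?thesis
        by (simp add: box_norm_def)
    qed
    then show "((\<lambda>s. box_norm a b (\<gamma> s) (D s)) has_integral (MAX j. \<bar>u q j - u p j\<bar>)) {0..1}"
      using has_integral_const_real[of "MAX j. \<bar>u q j - u p j\<bar>" 0 1] by simp
  qed
  moreover have "path_distance (box_norm a b) (box a b) (\<gamma> 0) (\<gamma> 1)
      \<le> curve_length (box_norm a b) \<gamma>"
    using contD d in_box box_norm_nonneg
    by (intro path_distance_le piecewise_C1_curveI continuous_on_box_norm) auto
  moreover have "\<gamma> 0 = p" "\<gamma> 1 = q"
    using p q by (auto simp: \<gamma>_def u_def vec_eq_iff mem_box_cart strip_point_coord)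
  ultimately show ?thesis
    by (simp add: box_distance_def u_def)
qed

lemma box_distance_eq:
  assumes "p \<in> box a b" "q \<in> box a b"
  shows "box_distance a b p q =
    (MAX j. \<bar>strip_coord (a $ j) (b $ j) (q $ j) - strip_coord (a $ j) (b $ j) (p $ j)\<bar>)"
proof (rule antisym[OF box_distance_le[OF assms]])
  obtain j where "(MAX j. \<bar>strip_coord (a $ j) (b $ j) (q $ j) - strip_coord (a $ j) (b $ j) (p $ j)\<bar>)
      = \<bar>strip_coord (a $ j) (b $ j) (q $ j) - strip_coord (a $ j) (b $ j) (p $ j)\<bar>"
    by (rule MAX_attained)
  then show "(MAX j. \<bar>strip_coord (a $ j) (b $ j) (q $ j) - strip_coord (a $ j) (b $ j) (p $ j)\<bar>)
      \<le> box_distance a b p q"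
    using box_distance_ge[OF assms] by simp
qed

section \<open>The Kobayashi-Royden metric and the Kobayashi distance of the strip product\<close>

lemma holomorphic_disk_strip_product:
  fixes \<phi> :: "complex \<Rightarrow> complex ^ 'n"
  assumes "holomorphic_disk (strip_product a b) \<phi>"
  shows "(\<lambda>z. \<phi> z $ j) holomorphic_on ball 0 1"
    and "z \<in> ball 0 1 \<Longrightarrow> a $ j < Re (\<phi> z $ j) \<and> Re (\<phi> z $ j) < b $ j"
  using assms by (auto simp: holomorphic_disk_def strip_product_def image_subset_iff)

text \<open>The components of a map into a product are independent, so base point and slope may be
  chosen separately in each coordinate.\<close>

lemma holomorphic_disk_strip_disks:
  assumes "\<And>j. \<bar>c j\<bar> \<le> 1"
  shows "holomorphic_disk (strip_product a b) (\<lambda>z. \<chi> j. strip_disk (a $ j) (b $ j) (t j) (c j) z)"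
proof -
  have "(\<chi> j. strip_disk (a $ j) (b $ j) (t j) (c j) z) \<in> strip_product a b"
    if "z \<in> ball 0 1" for z
    using strip_disk_bounds[OF _ assms that] ab by (simp add: strip_product_def)
  then show ?thesis
    using strip_disk_holomorphic[OF assms] by (auto simp: holomorphic_disk_def)
qed

text \<open>By \<open>le_m\<close> the slopes \<open>v $ j / (m * A j)\<close> lie in
  \<open>[-1, 1]\<close>, so a single disk with scalar \<open>m\<close> attains \<open>v\<close> in
  all components. Conversely \<open>strip_disk_derivative_le\<close>, in a coordinate where the
  maximum is attained, bounds every admissible scalar from below.\<close>

lemma box_norm_eq_kobayashi_royden:
  assumes p: "p \<in> box a b"
  shows "box_norm a b p v =
    2 * kobayashi_royden (strip_product a b) (complex_vec p) (complex_vec v)"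
proof -
  define m where "m = box_norm a b p v / 2"
  define A where "A j = strip_density (a $ j) (b $ j) (p $ j)" for j
  have pj: "a $ j < p $ j" "p $ j < b $ j" for j
    using p by (auto simp: mem_box_cart)
  have A: "0 < A j" for j
    unfolding A_def by (rule strip_density_pos[OF pj])
  have m: "0 \<le> m"
    using box_norm_nonneg[OF p] by (simp add: m_def)
  have le_m: "\<bar>v $ j\<bar> \<le> m * A j" for j
  proof -
    have "2 * \<bar>v $ j\<bar> / A j \<le> box_norm a b p v"
      unfolding box_norm_def A_def by (rule MAX_upper)
    then show ?thesis
      using A[of j] by (simp add: m_def field_simps)
  qed
  have "kobayashi_royden (strip_product a b) (complex_vec p) (complex_vec v) = m"
    unfolding kobayashi_royden_def
  proof (rule cInf_eq_attained[of "cmod (of_real m)"])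
    \<comment> \<open>If \<open>m = 0\<close>, then \<open>v = 0\<close> and the junk value \<open>c j = 0\<close> is the right one.\<close>
    define c where "c j = v $ j / (m * A j)" for j
    define \<phi> where "\<phi> z = (\<chi> j. strip_disk (a $ j) (b $ j)
      (strip_coord (a $ j) (b $ j) (p $ j)) (c j) z)" for z
    have "\<bar>c j\<bar> \<le> 1" for j
      using le_m[of j] m A[of j] by (cases "m = 0") (auto simp: c_def abs_mult divide_le_eq_1)
    then have "holomorphic_disk (strip_product a b) \<phi>"
      unfolding \<phi>_def by (rule holomorphic_disk_strip_disks)
    moreover have "\<phi> 0 = complex_vec p"
      using strip_disk_of_real[of 0] strip_point_coord[OF pj]
      by (simp add: \<phi>_def complex_vec_def)
    moreover have "of_real m * deriv (\<lambda>z. \<phi> z $ j) 0 = of_real (v $ j)" for j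
    proof -
      have "(\<lambda>z. \<phi> z $ j) = strip_disk (a $ j) (b $ j) (strip_coord (a $ j) (b $ j) (p $ j)) (c j)"
        by (simp add: \<phi>_def fun_eq_iff)
      then have "deriv (\<lambda>z. \<phi> z $ j) 0 = of_real (c j * A j)"
        using ab by (simp only: deriv_strip_disk_0 strip_point_coord[OF pj] A_def)
      moreover have "m * (c j * A j) = v $ j"
        using A[of j] le_m[of j] by (cases "m = 0") (auto simp: c_def)
      ultimately show ?thesis
        by (simp only: of_real_mult[symmetric])
    qed
    then have "of_real m *s (\<chi> j. deriv (\<lambda>z. \<phi> z $ j) 0) = complex_vec v"
      by (simp add: vec_eq_iff complex_vec_def)
    ultimately show "cmod (of_real m) \<in> {cmod \<alpha> |\<alpha> \<phi>. holomorphic_disk (strip_product a b) \<phi> \<and>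
        \<phi> 0 = complex_vec p \<and> \<alpha> *s (\<chi> j. deriv (\<lambda>z. \<phi> z $ j) 0) = complex_vec v}"
      by blast
    show "cmod (of_real m) \<le> m"
      using m by simp
  next
    fix y assume "y \<in> {cmod \<alpha> |\<alpha> \<phi>. holomorphic_disk (strip_product a b) \<phi> \<and>
        \<phi> 0 = complex_vec p \<and> \<alpha> *s (\<chi> j. deriv (\<lambda>z. \<phi> z $ j) 0) = complex_vec v}"
    then obtain \<alpha> \<phi> where y: "y = cmod \<alpha>" and \<phi>: "holomorphic_disk (strip_product a b) \<phi>"
      "\<phi> 0 = complex_vec p" and eq: "\<alpha> *s (\<chi> j. deriv (\<lambda>z. \<phi> z $ j) 0) = complex_vec v"
      by blast
    have le: "2 * \<bar>v $ j\<bar> / A j \<le> 2 * y" for j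
    proof -
      have "cmod (deriv (\<lambda>z. \<phi> z $ j) 0) \<le> A j"
        unfolding A_def by (rule strip_disk_derivative_le)
          (use holomorphic_disk_strip_product[OF \<phi>(1)] \<phi>(2) in \<open>auto simp: complex_vec_def\<close>)
      then have "cmod (\<alpha> * deriv (\<lambda>z. \<phi> z $ j) 0) \<le> cmod \<alpha> * A j"
        by (simp add: norm_mult mult_left_mono)
      moreover have "\<alpha> * deriv (\<lambda>z. \<phi> z $ j) 0 = of_real (v $ j)"
        using eq by (simp add: vec_eq_iff complex_vec_def)
      ultimately show ?thesis
        using A[of j] y by (simp add: field_simps)
    qed
    obtain j where "box_norm a b p v = 2 * \<bar>v $ j\<bar> / A j"
      unfolding box_norm_def A_def by (rule MAX_attained)
    then show "m \<le> y"
      using le[of j] by (simp add: m_def)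
  qed
  then show ?thesis
    by (simp add: m_def)
qed

text \<open>The link estimates telescope. Intermediate points \<open>P i\<close> may leave the real
  axis, hence the use of \<open>h\<close>, defined on the whole strip, in place of
  \<open>strip_coord\<close>.\<close>

lemma disk_chain_ge:
  fixes P :: "nat \<Rightarrow> complex ^ 'n" and j :: 'n
  assumes chain: "\<And>i. i < N \<Longrightarrow> holomorphic_disk (strip_product a b) (\<phi> i) \<and>
      \<zeta> i \<in> ball 0 1 \<and> \<omega> i \<in> ball 0 1 \<and> \<phi> i (\<zeta> i) = P i \<and> \<phi> i (\<omega> i) = P (Suc i)"
  defines "h \<equiv> \<lambda>w. Re (Ln (strip_tan (a $ j) (b $ j) (w $ j)))"
  shows "\<bar>h (P N) - h (P 0)\<bar> \<le> 2 * (\<Sum>i<N. poincare_distance (\<zeta> i) (\<omega> i))"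
  using chain
proof (induction N)
  case (Suc N)
  have disk: "holomorphic_disk (strip_product a b) (\<phi> N)" "\<zeta> N \<in> ball 0 1" "\<omega> N \<in> ball 0 1"
    "\<phi> N (\<zeta> N) = P N" "\<phi> N (\<omega> N) = P (Suc N)"
    using Suc.prems[of N] by auto
  have "\<bar>h (P (Suc N)) - h (P N)\<bar> \<le> 2 * poincare_distance (\<zeta> N) (\<omega> N)"
    unfolding h_def disk(4,5)[symmetric]
    by (rule strip_disk_log_bound[OF holomorphic_disk_strip_product[OF disk(1)] disk(2,3)])
  moreover have "\<bar>h (P N) - h (P 0)\<bar> \<le> 2 * (\<Sum>i<N. poincare_distance (\<zeta> i) (\<omega> i))"
    using Suc by auto
  ultimately show ?case
    by simp
qed simp

text \<open>A chain of one disk through \<open>p\<close> and \<open>q\<close> attains the infimum;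
  \<open>disk_chain_ge\<close> bounds all other chains from below.\<close>

lemma box_distance_eq_kobayashi_distance:
  assumes p: "p \<in> box a b" and q: "q \<in> box a b"
  shows "box_distance a b p q =
    2 * kobayashi_distance (strip_product a b) (complex_vec p) (complex_vec q)"
proof -
  define u where "u x j = strip_coord (a $ j) (b $ j) (x $ j)" for x :: "real ^ 'n" and j
  define M where "M = (MAX j. \<bar>u q j - u p j\<bar>)"
  have pj: "a $ j < p $ j" "p $ j < b $ j" and qj: "a $ j < q $ j" "q $ j < b $ j" for j
    using p q by (auto simp: mem_box_cart)
  have le_M: "\<bar>u q j - u p j\<bar> \<le> M" for j
    unfolding M_def by (rule MAX_upper)
  then have M: "0 \<le> M"
    by (meson abs_ge_zero order_trans)
  have "kobayashi_distance (strip_product a b) (complex_vec p) (complex_vec q) = M / 2"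
    unfolding kobayashi_distance_def
  proof (rule cInf_eq_attained)
    \<comment> \<open>Chosen so that the radius from 0 to \<open>r\<close> has hyperbolic length
      \<open>M / 2\<close>.\<close>
    define r where "r = tanh (M / 2)"
    \<comment> \<open>Going from 0 to \<open>r\<close> then moves coordinate \<open>j\<close> by
      \<open>c j * M = u q j - u p j\<close>. If \<open>M = 0\<close>, division yields
      \<open>c j = 0\<close>, and both sides vanish by \<open>le_M\<close>.\<close>
    define c where "c j = (u q j - u p j) / M" for j
    define \<phi> where "\<phi> z = (\<chi> j. strip_disk (a $ j) (b $ j) (u p j) (c j) z)" for z
    have r: "0 \<le> r" "r < 1"
      using M tanh_real_lt_1 by (auto simp: r_def)
    have "artanh r = M / 2"
      by (simp add: r_def artanh_tanh_real)
    then have ln_r: "ln ((1 + r) / (1 - r)) = M"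
      by (simp add: artanh_def)
    have "\<bar>c j\<bar> \<le> 1" for j
      using le_M[of j] M by (auto simp: c_def divide_le_eq_1)
    then have "holomorphic_disk (strip_product a b) \<phi>"
      unfolding \<phi>_def by (rule holomorphic_disk_strip_disks)
    moreover have "\<phi> 0 = complex_vec p"
      using strip_disk_of_real[of 0] strip_point_coord[OF pj]
      by (simp add: \<phi>_def complex_vec_def u_def)
    moreover have "\<phi> (of_real r) = complex_vec q"
    proof -
      have "u p j + c j * M = u q j" for j
        using le_M[of j] by (cases "M = 0") (auto simp: c_def)
      then show ?thesis
        using r strip_point_coord[OF qj]
        by (simp add: \<phi>_def complex_vec_def strip_disk_of_real ln_r) (simp add: u_def)
    qed
    \<comment> \<open>The chain has one link, so \<open>P\<close> takes the value
      \<open>complex_vec p\<close> at 0 and \<open>complex_vec q\<close> at 1.\<close>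
    ultimately have ex: "\<exists>P \<phi> \<zeta> \<omega>. poincare_distance 0 (of_real r) =
          (\<Sum>i<Suc 0. poincare_distance (\<zeta> i) (\<omega> i)) \<and>
        P 0 = complex_vec p \<and> P (Suc 0) = complex_vec q \<and>
        (\<forall>i<Suc 0. holomorphic_disk (strip_product a b) (\<phi> i) \<and> \<zeta> i \<in> ball 0 1 \<and> \<omega> i \<in> ball 0 1 \<and>
           \<phi> i (\<zeta> i) = P i \<and> \<phi> i (\<omega> i) = P (Suc i))"
      using r
      by (intro exI[of _ "case_nat (complex_vec p) (\<lambda>_. complex_vec q)"] exI[of _ "\<lambda>_. \<phi>"]
          exI[of _ "\<lambda>_. 0"] exI[of _ "\<lambda>_. of_real r"]) auto
    then show "poincare_distance 0 (of_real r) \<in>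
        {(\<Sum>i<N. poincare_distance (\<zeta> i) (\<omega> i)) |N P \<phi> \<zeta> \<omega>.
            P 0 = complex_vec p \<and> P N = complex_vec q \<and>
            (\<forall>i<N. holomorphic_disk (strip_product a b) (\<phi> i) \<and> \<zeta> i \<in> ball 0 1 \<and> \<omega> i \<in> ball 0 1 \<and>
               \<phi> i (\<zeta> i) = P i \<and> \<phi> i (\<omega> i) = P (Suc i))}"
      by blast
    show "poincare_distance 0 (of_real r) \<le> M / 2"
      using poincare_distance_0_le[OF r] by (simp add: ln_r)
  next
    fix y assume "y \<in> {(\<Sum>i<N. poincare_distance (\<zeta> i) (\<omega> i)) |N P \<phi> \<zeta> \<omega>.
            P 0 = complex_vec p \<and> P N = complex_vec q \<and>
            (\<forall>i<N. holomorphic_disk (strip_product a b) (\<phi> i) \<and> \<zeta> i \<in> ball 0 1 \<and> \<omega> i \<in> ball 0 1 \<and>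
               \<phi> i (\<zeta> i) = P i \<and> \<phi> i (\<omega> i) = P (Suc i))}"
    then obtain N P \<phi> \<zeta> \<omega> where y: "y = (\<Sum>i<N. poincare_distance (\<zeta> i) (\<omega> i))"
      and P: "P 0 = complex_vec p" "P N = complex_vec q"
      and chain: "\<And>i. i < N \<Longrightarrow> holomorphic_disk (strip_product a b) (\<phi> i) \<and>
        \<zeta> i \<in> ball 0 1 \<and> \<omega> i \<in> ball 0 1 \<and> \<phi> i (\<zeta> i) = P i \<and> \<phi> i (\<omega> i) = P (Suc i)"
      by blast
    obtain j where j: "M = \<bar>u q j - u p j\<bar>"
      unfolding M_def by (rule MAX_attained)
    \<comment> \<open>At the real end points the potential of \<open>disk_chain_ge\<close> agrees
      with \<open>u\<close>.\<close>
    have "\<bar>u q j - u p j\<bar> \<le> 2 * y"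
      using disk_chain_ge[where j = j, of N \<phi> \<zeta> \<omega> P] chain y
      by (simp add: P complex_vec_def Ln_strip_tan_of_real[OF pj] Ln_strip_tan_of_real[OF qj] u_def)
    then show "M / 2 \<le> y"
      by (simp add: j)
  qed
  then show ?thesis
    using box_distance_eq[OF p q] by (simp add: M_def u_def)
qed

section \<open>Metric axioms and completeness\<close>

lemma box_distance_coord_le:
  assumes "p \<in> box a b" "q \<in> box a b"
  shows "box_distance a b p q \<le> e \<longleftrightarrow>
    (\<forall>j. \<bar>strip_coord (a $ j) (b $ j) (q $ j) - strip_coord (a $ j) (b $ j) (p $ j)\<bar> \<le> e)"
  by (simp add: box_distance_eq[OF assms])

lemma Metric_space_box: "Metric_space (box a b) (box_distance a b)"
proof
  \<comment> \<open>Nonnegativity and symmetry are demanded for all points, also off the box, where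
    the distance is 0 by convention.\<close>
  have off: "box_distance a b x y = 0" if "\<not> (x \<in> box a b \<and> y \<in> box a b)" for x y
    unfolding box_distance_def path_distance_def using that by (simp only: if_False)
  show nonneg: "0 \<le> box_distance a b x y" for x y
    using off[of x y] box_distance_ge[of x y] abs_ge_zero by (metis order_refl order_trans)
  show "box_distance a b x y = box_distance a b y x" for x y
  proof (cases "x \<in> box a b \<and> y \<in> box a b")
    case True
    then show ?thesis
      by (simp add: box_distance_eq abs_minus_commute)
  next
    case False
    then show ?thesis
      using off by metis
  qed
  fix x y assume x: "x \<in> box a b" and y: "y \<in> box a b"
  show "box_distance a b x y = 0 \<longleftrightarrow> x = y"
  proof
    assume "box_distance a b x y = 0"
    then have "strip_coord (a $ j) (b $ j) (y $ j) = strip_coord (a $ j) (b $ j) (x $ j)" for j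
      using box_distance_ge[OF x y, of j] by simp
    \<comment> \<open>The hyperbolic coordinate is injective, with left inverse
      \<open>strip_point\<close>.\<close>
    then have "y $ j = x $ j" for j
      using x y by (metis mem_box_cart strip_point_coord)
    then show "x = y"
      by (simp add: vec_eq_iff)
  qed (use x in \<open>simp add: box_distance_eq\<close>)
  fix z assume z: "z \<in> box a b"
  show "box_distance a b x z \<le> box_distance a b x y + box_distance a b y z"
    unfolding box_distance_coord_le[OF x z]
  proof
    fix j
    show "\<bar>strip_coord (a $ j) (b $ j) (z $ j) - strip_coord (a $ j) (b $ j) (x $ j)\<bar>
      \<le> box_distance a b x y + box_distance a b y z"
      using box_distance_ge[OF x y, of j] box_distance_ge[OF y z, of j] by linarith
  qed
qed

interpretation box_metric: Metric_space "box a b" "box_distance a b"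
  by (rule Metric_space_box)

text \<open>The hyperbolic coordinates form an isometry onto all of R^n with the maximum norm:
  limits are taken in each coordinate and carried back by \<open>strip_point\<close>, whose values
  stay strictly inside the interval.\<close>

lemma mcomplete_box: "box_metric.mcomplete"
  unfolding box_metric.mcomplete_def
proof (intro allI impI)
  fix \<sigma> assume Cauchy: "box_metric.MCauchy \<sigma>"
  then have \<sigma>: "\<sigma> n \<in> box a b" for n
    unfolding box_metric.MCauchy_def by blast
  define u where "u x j = strip_coord (a $ j) (b $ j) (x $ j)" for x :: "real ^ 'n" and j
  have "Cauchy (\<lambda>n. u (\<sigma> n) j)" for j
  proof (rule metric_CauchyI)
    fix e :: real assume "0 < e"
    then obtain N where N: "\<And>n n'. N \<le> n \<Longrightarrow> N \<le> n' \<Longrightarrow> box_distance a b (\<sigma> n) (\<sigma> n') < e"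
      using Cauchy unfolding box_metric.MCauchy_def by blast
    have "dist (u (\<sigma> m) j) (u (\<sigma> n) j) < e" if "N \<le> m" "N \<le> n" for m n
      using N[OF that(2,1)] box_distance_ge[OF \<sigma>[of n] \<sigma>[of m], of j]
      by (simp add: dist_real_def u_def)
    then show "\<exists>N. \<forall>m\<ge>N. \<forall>n\<ge>N. dist (u (\<sigma> m) j) (u (\<sigma> n) j) < e"
      by blast
  qed
  then have "\<exists>l. (\<lambda>n. u (\<sigma> n) j) \<longlonglongrightarrow> l" for j
    using Cauchy_convergent_iff convergent_def by blast
  then obtain l where l: "\<And>j. (\<lambda>n. u (\<sigma> n) j) \<longlonglongrightarrow> l j"
    by metis
  define x :: "real ^ 'n" where "x = (\<chi> j. strip_point (a $ j) (b $ j) (l j))"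
  have x: "x \<in> box a b"
    using ab by (simp add: x_def mem_box_cart strip_point_bounds)
  have ux: "u x j = l j" for j
    using ab by (simp add: u_def x_def strip_coord_point)
  have "eventually (\<lambda>n. box_distance a b (\<sigma> n) x < e) sequentially" if "0 < e" for e
  proof -
    \<comment> \<open>Finitely many coordinates give one common threshold; \<open>e / 2\<close>
      leaves room to pass from the weak bound on the maximum to a strict one.\<close>
    have "eventually (\<lambda>n. \<forall>j. dist (u (\<sigma> n) j) (l j) < e / 2) sequentially"
      using tendstoD[OF l half_gt_zero[OF that]] by (rule eventually_all_finite)
    then show ?thesis
    proof (rule eventually_mono)
      fix n assume "\<forall>j. dist (u (\<sigma> n) j) (l j) < e / 2"
      then have "\<forall>j. \<bar>u x j - u (\<sigma> n) j\<bar> \<le> e / 2"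
        by (simp add: ux dist_real_def abs_minus_commute less_imp_le)
      then have "box_distance a b (\<sigma> n) x \<le> e / 2"
        unfolding box_distance_coord_le[OF \<sigma> x] u_def .
      then show "box_distance a b (\<sigma> n) x < e"
        using that by simp
    qed
  qed
  then have "limitin box_metric.mtopology \<sigma> x sequentially"
    using x \<sigma> by (simp add: box_metric.limitin_metric)
  then show "\<exists>x. limitin box_metric.mtopology \<sigma> x sequentially"
    by blast
qed

section \<open>Real points of the strip product, and the distance as the logarithm of a quotient of
  tangents\<close>

lemma complex_vec_image_box: "complex_vec ` box a b = strip_product a b \<inter> range complex_vec"
  by (auto simp: complex_vec_def strip_product_def mem_box_cart)

lemma strip_coord_diff:
  assumes "p \<in> box a b" "q \<in> box a b"
  shows "strip_coord (a $ j) (b $ j) (q $ j) - strip_coord (a $ j) (b $ j) (p $ j) =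
    ln (tan (pi * (q $ j - a $ j) / (2 * (b $ j - a $ j))) /
      tan (pi * (p $ j - a $ j) / (2 * (b $ j - a $ j))))"
proof -
  have "0 < tan (pi * (x $ j - a $ j) / (2 * (b $ j - a $ j)))" if "x \<in> box a b" for x
    using that by (intro strip_tan_angle_pos) (auto simp: mem_box_cart)
  from this[OF assms(1)] this[OF assms(2)] show ?thesis
    unfolding strip_coord_def by (rule ln_divide_pos[symmetric, rotated])
qed

end

theorem mainTheorem9:
  fixes a b :: "real ^ 'n"
  assumes "\<forall>j. a $ j < b $ j"
  shows "complex_vec ` box a b = strip_product a b \<inter> range complex_vec \<and>
     (\<forall>p\<in>box a b. \<forall>v.
           box_norm a b p v =
             2 * kobayashi_royden (strip_product a b) (complex_vec p) (complex_vec v)) \<and>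
     (\<forall>p\<in>box a b. \<forall>q\<in>box a b.
           box_distance a b p q =
             2 * kobayashi_distance (strip_product a b) (complex_vec p) (complex_vec q)) \<and>
     (\<forall>p\<in>box a b. \<forall>q\<in>box a b.
           box_distance a b p q =
             (MAX j. \<bar>ln (tan (pi * (q $ j - a $ j) / (2 * (b $ j - a $ j))) /
                        tan (pi * (p $ j - a $ j) / (2 * (b $ j - a $ j))))\<bar>)) \<and>
     Metric_space (box a b) (box_distance a b) \<and>
     Metric_space.mcomplete (box a b) (box_distance a b)"
proof (intro conjI ballI allI)
  fix p q assume "p \<in> box a b" "q \<in> box a b"
  then show "box_distance a b p q =
      (MAX j. \<bar>ln (tan (pi * (q $ j - a $ j) / (2 * (b $ j - a $ j))) /
                 tan (pi * (p $ j - a $ j) / (2 * (b $ j - a $ j))))\<bar>)"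
    by (simp only: box_distance_eq[OF assms] strip_coord_diff[OF assms])
qed (simp_all only: complex_vec_image_box[OF assms] box_norm_eq_kobayashi_royden[OF assms]
      box_distance_eq_kobayashi_distance[OF assms] Metric_space_box[OF assms]
      mcomplete_box[OF assms])

end
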